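(* For any two Cauchy sequences of rational numbers $\{x^{(n)}\}_{n\in\mathbb N}$, $\{y^{(n)}\}_{n\in\mathbb N}$, $$\kappa\big(\{x^{(n)}\}_{n\in\mathbb N}\,\widehat{\boxplus}\,\{y^{(n)}\}_{n\in\mathbb N}\big)=\kappa\big(\{x^{(n)}\}_{n\in\mathbb N}\big)\,\widehat{\oplus}\,\kappa\big(\{y^{(n)}\}_{n\in\mathbb N}\big).$$
   Context: $\mathbb N=\{1,2,3,\dots\}$ and $\mathcal Z_{10}=\{0,1,\dots,9\}$. $\mathcal R$ is the set of all formal decimals $x=x_0.x_1x_2x_3\cdots$ with $x_0\in\mathbb Z$ and $x_k\in\mathcal Z_{10}$ for $k\in\mathbb N$; two elements are equal iff all their digits agree. For $k\in\mathbb N$, $[x]_k=\sum_{i=0}^k x_i10^{-i}\in\mathbb Q$. Order on $\mathcal R$: $x\preceq y$ iff $[x]_k\le [y]_k$ for all $k\in\mathbb N$. Every nonempty bounded above (below) subset of $(\mathcal R,\preceq)$ has a supremum (infimum). $x\sim y$ ("no gap") means that there is no $z\in\mathcal R\setminus\{x,y\}$ lying strictly between $x$ and $y$ with respect to $\preceq$; $\sim$ is an equivalence relation, $\mathbb R:=\mathcal R/\sim$, and $[x]$ denotes the class of $x$. $\mathbb Q$ is regarded as a subset of $\mathcal R$ via long division: $\alpha=q/p$ ($p\in\mathbb N$, $q\in\mathbb Z$) is identified with $\alpha_0.\alpha_1\alpha_2\cdots$, where $\alpha_0=\lfloor q/p\rfloor$, $\beta_0=q-\alpha_0p$, $\alpha_{k+1}=\lfloor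 10\beta_k/p\rfloor$, $\beta_{k+1}=10\beta_k-\alpha_{k+1}p$. For a bounded sequence $\{x^{(n)}\}_{n\in\mathbb N}$ in $\mathcal R$: $\overline{\mathrm{LIMIT}}(\{x^{(n)}\})=\inf\{\sup\{x^{(k)}: k\ge n\}: n\in\mathbb N\}$ and $\underline{\mathrm{LIMIT}}(\{x^{(n)}\})=\sup\{\inf\{x^{(k)}: k\ge n\}: n\in\mathbb N\}$, with $\sup$, $\inf$ taken in $(\mathcal R,\preceq)$; if they are equal, the common value is denoted $\mathrm{LIMIT}(\{x^{(n)}\})$. It exists for bounded monotone sequences. Addition on $\mathcal R$: $x\oplus y=\mathrm{LIMIT}(\{[x]_k+[y]_k\}_{k\in\mathbb N})$, sums taken in $\mathbb Q$. It respects $\sim$, and $[x]\,\widehat\oplus\,[y]:=[x\oplus y]$ on $\mathbb R$. A sequence of rational numbers $\{x^{(n)}\}_{n\in\mathbb N}$ is Cauchy if for every rational $\epsilon>0$ there is $N\in\mathbb N$ such that $|x^{(m)}-x^{(n)}|<\epsilon$ for all $m,n\ge N$. $\mathbf{CR}$ is the set of all such sequences. For every Cauchy sequence of rationals the lower and upper limits are $\sim$-equivalent, and $\kappa:\mathbf{CR}\to\mathcal R/\sim$ is defined by $\kappa(\{x^{(n)}\})=[\underline{\mathrm{LIMIT}}(\{x^{(n)}\})]=[\overline{\mathrm{LIMIT}}(\{x^{(n)}\})]$. Addition of Cauchy sequences is termwise: $\{x^{(n)}\}\,\widehat\boxplus\,\{y^{(n)}\}=\{x^{(n)}+y^{(n)}\}$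 (sum in $\mathbb Q$), which is again Cauchy. *)

theory Defs
  imports Complex_Main
begin

text \<open>
  A formal decimal \<open>x\<^sub>0.x\<^sub>1x\<^sub>2x\<^sub>3\<dots>\<close> has an arbitrary integer \<open>x\<^sub>0\<close> in front of the point; for
  negative \<open>x\<^sub>0\<close> it stands for \<open>x\<^sub>0 + 0.x\<^sub>1x\<^sub>2\<dots>\<close>, not for \<open>-(\<bar>x\<^sub>0\<bar>.x\<^sub>1x\<^sub>2\<dots>)\<close>.
  Expansions ending in nines are not identified with any other expansion.
\<close>

typedef decimal = "{d :: nat \<Rightarrow> int. \<forall>k\<ge>1. d k \<in> {0..9}}"
  morphisms digit Decimal
  by (rule exI[of _ "\<lambda>_. 0"]) simp

setup_lifting type_definition_decimal

definition trunc :: "decimal \<Rightarrow> nat \<Rightarrow> rat" where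
  "trunc x k = (\<Sum>i\<le>k. of_int (digit x i) / 10 ^ i)"

text \<open>The integer \<open>10\<^sup>k [x]\<^sub>k\<close>; used in proofs only.\<close>

primrec scaled :: "decimal \<Rightarrow> nat \<Rightarrow> int" where
  "scaled x 0 = digit x 0"
| "scaled x (Suc k) = 10 * scaled x k + digit x (Suc k)"

lemma trunc_scaled: "trunc x k = of_int (scaled x k) / 10 ^ k"
  by (induction k) (simp_all add: trunc_def field_simps)

lemma trunc_le_iff: "trunc x k \<le> trunc y k \<longleftrightarrow> scaled x k \<le> scaled y k"
  by (simp add: trunc_scaled divide_le_cancel)

lemma digit_bounds: "0 \<le> digit x (Suc k)" "digit x (Suc k) \<le> 9"
  using digit[of x] by auto

lemma scaled_less_Suc: "scaled x k < scaled y k \<Longrightarrow> scaled x (Suc k) < scaled y (Suc k)"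
  using digit_bounds[of x k] digit_bounds[of y k] by simp

lemma scaled_less_mono: "scaled x k < scaled y k \<Longrightarrow> k \<le> m \<Longrightarrow> scaled x m < scaled y m"
  by (induction m) (auto simp del: scaled.simps(2) simp: le_Suc_eq intro: scaled_less_Suc)

lemma scaled_inject: "(\<And>k. scaled x k = scaled y k) \<Longrightarrow> x = y"
proof -
  assume *: "\<And>k. scaled x k = scaled y k"
  have "digit x k = digit y k" for k
    using *[of k] *[of "k - 1"] by (cases k) auto
  then show ?thesis
    by (metis digit_inject ext)
qed

instantiation decimal :: linorder
begin

definition less_eq_decimal :: "decimal \<Rightarrow> decimal \<Rightarrow> bool" where
  "(x::decimal) \<le> y \<longleftrightarrow> (\<forall>k\<ge>1. trunc x k \<le> trunc y k)"

definition less_decimal :: "decimal \<Rightarrow> decimal \<Rightarrow> bool" where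
  "(x::decimal) < y \<longleftrightarrow> x \<le> y \<and> \<not> y \<le> x"

lemma decimal_le_scaled: "x \<le> y \<longleftrightarrow> (\<forall>k. scaled x k \<le> scaled y k)"
proof
  assume "x \<le> y"
  then have *: "scaled x k \<le> scaled y k" if "k \<ge> 1" for k
    using that by (simp add: less_eq_decimal_def trunc_le_iff)
  show "\<forall>k. scaled x k \<le> scaled y k"
  proof
    fix k
    show "scaled x k \<le> scaled y k"
      using *[of "Suc k"] scaled_less_Suc[of y k x] by fastforce
  qed
qed (simp add: less_eq_decimal_def trunc_le_iff)

instance
proof
  fix x y z :: decimal
  show "(x < y) = (x \<le> y \<and> \<not> y \<le> x)"
    by (rule less_decimal_def)
  show "x \<le> x"
    by (simp add: decimal_le_scaled)
  show "x \<le> y \<Longrightarrow> y \<le> z \<Longrightarrow> x \<le> z"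
    unfolding decimal_le_scaled by (meson order_trans)
  show "x \<le> y \<Longrightarrow> y \<le> x \<Longrightarrow> x = y"
    unfolding decimal_le_scaled by (intro scaled_inject) (meson order_antisym)
  show "x \<le> y \<or> y \<le> x"
    unfolding decimal_le_scaled
    by (metis linorder_le_cases not_less scaled_less_mono)
qed

end

lemma decimal_less_scaled: "x < y \<longleftrightarrow> (\<exists>k. scaled x k < scaled y k)"
  unfolding decimal_le_scaled not_le[symmetric] by simp

lemma decimal_Sup_exists:
  fixes A :: "decimal set"
  assumes "A \<noteq> {}" and "bdd_above A"
  shows "\<exists>s. (\<forall>x\<in>A. x \<le> s) \<and> (\<forall>u. (\<forall>x\<in>A. x \<le> u) \<longrightarrow> s \<le> u)"
proof -
  obtain u where u: "\<And>x. x \<in> A \<Longrightarrow> x \<le> u"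
    using assms by (auto simp: bdd_above_def)
  define S where "S k = (SUP x\<in>A. scaled x k)" for k
  have bdd: "bdd_above ((\<lambda>x. scaled x k) ` A)" for k
    using u by (intro bdd_aboveI[of _ "scaled u k"]) (auto simp: decimal_le_scaled)
  have le: "scaled x k \<le> S k" if "x \<in> A" for x k
    unfolding S_def using that bdd by (rule cSUP_upper)
  have least: "S k \<le> m" if "\<And>x. x \<in> A \<Longrightarrow> scaled x k \<le> m" for k m
    unfolding S_def using assms(1) that by (rule cSUP_least)
  have attained: "\<exists>x\<in>A. scaled x k = S k" for k
  proof (rule ccontr)
    assume "\<not> ?thesis"
    then have "scaled x k \<le> S k - 1" if "x \<in> A" for x
      using le[OF that, of k] that by force
    then have "S k \<le> S k - 1"
      by (rule least)
    then show False by simp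
  qed
  define d where "d k = (case k of 0 \<Rightarrow> S 0 | Suc j \<Rightarrow> S (Suc j) - 10 * S j)" for k
  have "0 \<le> d (Suc k) \<and> d (Suc k) \<le> 9" for k
  proof
    obtain x where "x \<in> A" "scaled x k = S k"
      using attained by blast
    then show "0 \<le> d (Suc k)"
      using le[of x "Suc k"] digit_bounds[of x k] by (simp add: d_def)
    have "S (Suc k) \<le> 10 * S k + 9"
    proof (rule least)
      fix x assume "x \<in> A"
      then show "scaled x (Suc k) \<le> 10 * S k + 9"
        using le[of x k] digit_bounds[of x k] by simp
    qed
    then show "d (Suc k) \<le> 9"
      by (simp add: d_def)
  qed
  then have "d k \<in> {0..9}" if "k \<ge> 1" for k
    using that by (cases k) auto
  then have digit: "digit (Decimal d) = d"
    by (intro Decimal_inverse) auto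
  have scaled: "scaled (Decimal d) k = S k" for k
    by (induction k) (simp_all add: digit, simp_all add: d_def)
  show ?thesis
    by (rule exI[of _ "Decimal d"]) (auto simp: decimal_le_scaled scaled intro: le least)
qed

lemma decimal_Inf_exists:
  fixes A :: "decimal set"
  assumes "A \<noteq> {}" and "bdd_below A"
  shows "\<exists>s. (\<forall>x\<in>A. s \<le> x) \<and> (\<forall>l. (\<forall>x\<in>A. l \<le> x) \<longrightarrow> l \<le> s)"
proof -
  let ?L = "{l. \<forall>a\<in>A. l \<le> a}"
  have "?L \<noteq> {}"
    using assms(2) by (auto simp: bdd_below_def)
  moreover obtain a where "a \<in> A"
    using assms(1) by blast
  then have "bdd_above ?L"
    by (intro bdd_aboveI[of _ a]) auto
  ultimately obtain s where "\<forall>x\<in>?L. x \<le> s" "\<forall>u. (\<forall>x\<in>?L. x \<le> u) \<longrightarrow> s \<le> u"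
    using decimal_Sup_exists[of ?L] by blast
  then show ?thesis
    by (intro exI[of _ s]) auto
qed

instantiation decimal :: distrib_lattice
begin

definition "(inf :: decimal \<Rightarrow> decimal \<Rightarrow> decimal) = min"

definition "(sup :: decimal \<Rightarrow> decimal \<Rightarrow> decimal) = max"

instance
  by standard (auto simp: inf_decimal_def sup_decimal_def max_min_distrib2)

end

instantiation decimal :: conditionally_complete_linorder
begin

definition Sup_decimal :: "decimal set \<Rightarrow> decimal" where
  "Sup A = (LEAST s :: decimal. \<forall>x\<in>A. x \<le> s)"

definition Inf_decimal :: "decimal set \<Rightarrow> decimal" where
  "Inf A = (GREATEST s :: decimal. \<forall>x\<in>A. s \<le> x)"

instance
proof
  fix x :: decimal and X :: "decimal set"
  {
    assume "X \<noteq> {}" "bdd_below X"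
    then obtain s where s: "\<forall>x\<in>X. s \<le> x" "\<And>l. \<forall>x\<in>X. l \<le> x \<Longrightarrow> l \<le> s"
      using decimal_Inf_exists by blast
    then have "Inf X = s"
      unfolding Inf_decimal_def by (intro Greatest_equality) auto
    with s have "(\<forall>x\<in>X. Inf X \<le> x) \<and> (\<forall>l. (\<forall>x\<in>X. l \<le> x) \<longrightarrow> l \<le> Inf X)"
      by auto
  } note Inf = this
  {
    assume "X \<noteq> {}" "bdd_above X"
    then obtain s where s: "\<forall>x\<in>X. x \<le> s" "\<And>l. \<forall>x\<in>X. x \<le> l \<Longrightarrow> s \<le> l"
      using decimal_Sup_exists by blast
    then have "Sup X = s"
      unfolding Sup_decimal_def by (intro Least_equality) auto
    with s have "(\<forall>x\<in>X. x \<le> Sup X) \<and> (\<forall>l. (\<forall>x\<in>X. x \<le> l) \<longrightarrow> Sup X \<le> l)"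
      by auto
  } note Sup = this
  show "x \<in> X \<Longrightarrow> bdd_below X \<Longrightarrow> Inf X \<le> x"
    using Inf by auto
  show "X \<noteq> {} \<Longrightarrow> (\<And>y. y \<in> X \<Longrightarrow> x \<le> y) \<Longrightarrow> x \<le> Inf X"
    using Inf by (auto simp: bdd_below_def)
  show "x \<in> X \<Longrightarrow> bdd_above X \<Longrightarrow> x \<le> Sup X"
    using Sup by auto
  show "X \<noteq> {} \<Longrightarrow> (\<And>y. y \<in> X \<Longrightarrow> y \<le> x) \<Longrightarrow> Sup X \<le> x"
    using Sup by (auto simp: bdd_above_def)
qed

end

primrec division_remainder :: "int \<Rightarrow> int \<Rightarrow> nat \<Rightarrow> int" where
  "division_remainder q p 0 = q - (q div p) * p"
| "division_remainder q p (Suc k) =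
    10 * division_remainder q p k - (10 * division_remainder q p k div p) * p"

primrec division_digit :: "int \<Rightarrow> int \<Rightarrow> nat \<Rightarrow> int" where
  "division_digit q p 0 = q div p"
| "division_digit q p (Suc k) = 10 * division_remainder q p k div p"

text \<open>
  These recursions are long division of \<open>q\<close> by \<open>p > 0\<close>; \<open>div\<close> rounds towards minus infinity, so
  \<open>q div p\<close> is \<open>\<lfloor>q/p\<rfloor>\<close> also for negative \<open>q\<close>. The expansion is computed from the
  representation in lowest terms; by \<open>digit_decimal_of_rat_Fract\<close> below any other fraction gives the same one.
\<close>

definition decimal_of_rat :: "rat \<Rightarrow> decimal" where
  "decimal_of_rat r = (case quotient_of r of (q, p) \<Rightarrow> Decimal (division_digit q p))"

lemma division_remainder_bounds:
  assumes "p > 0"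
  shows "0 \<le> division_remainder q p k" "division_remainder q p k < p"
  using assms by (cases k; simp add: minus_div_mult_eq_mod)+

lemma division_digit_bounds:
  assumes "p > 0" "k \<ge> 1"
  shows "division_digit q p k \<in> {0..9}"
proof -
  obtain j where k: "k = Suc j"
    using assms(2) by (cases k) auto
  note b = division_remainder_bounds[OF assms(1), of q j]
  have "10 * division_remainder q p j div p < 10"
  proof (rule ccontr)
    assume "\<not> ?thesis"
    then have "10 * p \<le> 10 * division_remainder q p j div p * p"
      using assms(1) by (intro mult_right_mono) auto
    also have "\<dots> \<le> 10 * division_remainder q p j"
      using assms(1) div_mult_mod_eq[of "10 * division_remainder q p j" p]
        pos_mod_sign[OF assms(1), of "10 * division_remainder q p j"] by linarith
    finally show False
      using b by simp
  qed
  moreover have "0 \<le> 10 * division_remainder q p j div p"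
    using b assms(1) by (simp add: pos_imp_zdiv_nonneg_iff)
  ultimately show ?thesis
    by (simp add: k)
qed

lemma div_eq_of_cross_mult:
  fixes a b p p' :: int
  assumes "p > 0" "p' > 0" "a * p' = b * p"
  shows "a div p = b div p'"
proof -
  have "a div p = (a * p') div (p * p')"
    using assms(2) by simp
  also have "\<dots> = (b * p) div (p' * p)"
    using assms(3) by (simp add: mult.commute)
  also have "\<dots> = b div p'"
    using assms(1) by simp
  finally show ?thesis .
qed

lemma division_cross_mult:
  fixes p p' :: int
  assumes "p > 0" "p' > 0" "q * p' = q' * p"
  shows "division_remainder q p k * p' = division_remainder q' p' k * p"
proof (induction k)
  case 0
  then show ?case
    using assms(3) div_eq_of_cross_mult[OF assms] by (simp add: algebra_simps)
next
  case (Suc k)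
  then have "10 * division_remainder q p k div p = 10 * division_remainder q' p' k div p'"
    using assms(1,2) by (intro div_eq_of_cross_mult) auto
  then show ?case
    using Suc by (simp add: algebra_simps)
qed

lemma digit_decimal_of_rat_Fract:
  assumes "p > 0"
  shows "digit (decimal_of_rat (Fract q p)) = division_digit q p"
proof -
  obtain q' p' where qp: "quotient_of (Fract q p) = (q', p')"
    by fastforce
  then have p': "p' > 0" and eq: "Fract q p = Fract q' p'"
    using quotient_of_denom_pos quotient_of_div Fract_of_int_quotient by auto
  have cross: "q' * p = q * p'"
    using eq p' assms by (simp add: eq_rat)
  have "division_digit q' p' k = division_digit q p k" for k
    using division_cross_mult[OF p' assms cross] p' assms cross
    by (cases k) (auto intro!: div_eq_of_cross_mult)
  then have "division_digit q' p' = division_digit q p"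
    by auto
  moreover have "digit (Decimal (division_digit q' p')) = division_digit q' p'"
    using division_digit_bounds[OF p'] by (intro Decimal_inverse) auto
  ultimately show ?thesis
    by (simp add: decimal_of_rat_def qp)
qed

definition no_gap :: "decimal \<Rightarrow> decimal \<Rightarrow> bool"  (infix \<open>\<sim>\<close> 50) where
  "x \<sim> y \<longleftrightarrow> \<not> (\<exists>z. (x < z \<and> z < y) \<or> (y < z \<and> z < x))"

text \<open>
  The real number represented by a formal decimal serves only to prove that the definitions
  below are sound; none of them refers to it.
\<close>

definition val :: "decimal \<Rightarrow> real" where
  "val x = (SUP k. real_of_int (scaled x k) / 10 ^ k)"

lemma scaled_diff: 
  "scaled x k * 10 ^ j \<le> scaled x (k + j) \<and> scaled x (k + j) < (scaled x k + 1) * 10 ^ j"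
proof (induction j)
  case (Suc j)
  then show ?case
    using digit_bounds[of x "k + j"] by (simp add: algebra_simps)
qed simp

lemma scaled_le_scaled_plus1:
  "real_of_int (scaled x m) / 10 ^ m \<le> (real_of_int (scaled x k) + 1) / 10 ^ k"
proof (cases "m \<le> k")
  case True
  then obtain j where k: "k = m + j"
    using le_Suc_ex by blast
  have "scaled x m * 10 ^ j \<le> scaled x k + 1"
    using scaled_diff[of x m j] k by simp
  then have "real_of_int (scaled x m * 10 ^ j) \<le> real_of_int (scaled x k + 1)"
    by (rule of_int_le_iff[THEN iffD2])
  then show ?thesis
    by (simp add: k power_add field_simps)
next
  case False
  then obtain j where m: "m = k + j"
    using le_Suc_ex by (metis nat_le_linear)
  have "scaled x m \<le> (scaled x k + 1) * 10 ^ j"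
    using scaled_diff[of x k j] m by simp
  then have "real_of_int (scaled x m) \<le> real_of_int ((scaled x k + 1) * 10 ^ j)"
    by (rule of_int_le_iff[THEN iffD2])
  then show ?thesis
    by (simp add: m power_add field_simps)
qed

lemma val_lower: "real_of_int (scaled x k) / 10 ^ k \<le> val x"
  unfolding val_def
  by (rule cSUP_upper) (auto intro!: bdd_aboveI[of _ "(real_of_int (scaled x 0) + 1) / 10 ^ 0"] scaled_le_scaled_plus1[where k = 0, simplified])

lemma val_upper: "val x \<le> (real_of_int (scaled x k) + 1) / 10 ^ k"
  unfolding val_def by (rule cSUP_least) (auto intro: scaled_le_scaled_plus1)

lemma val_mono: "x \<le> y \<Longrightarrow> val x \<le> val y"
  unfolding val_def[of x]
proof (rule cSUP_least)
  fix k assume "x \<le> y"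
  then have "real_of_int (scaled x k) / 10 ^ k \<le> real_of_int (scaled y k) / 10 ^ k"
    by (simp add: decimal_le_scaled divide_right_mono)
  also have "\<dots> \<le> val y"
    by (rule val_lower)
  finally show "real_of_int (scaled x k) / 10 ^ k \<le> val y" .
qed simp

lemma val_less_imp_less: "val x < val y \<Longrightarrow> x < y"
  using val_mono[of y x] by (metis not_le)

lemma small_power: "(e::real) > 0 \<Longrightarrow> \<exists>k. 1 / 10 ^ k < e"
  using real_arch_pow_inv[of e "1/10"] by (auto simp: power_one_over)

lemma val_eqI:
  assumes "\<And>k. real_of_int (scaled x k) / 10 ^ k \<le> r"
    and "\<And>k. r \<le> (real_of_int (scaled x k) + 1) / 10 ^ k"
  shows "val x = r"
proof (rule ccontr)
  assume "val x \<noteq> r"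
  then obtain k where "1 / 10 ^ k < \<bar>val x - r\<bar>"
    using small_power[of "\<bar>val x - r\<bar>"] by auto
  then show False
    using assms[of k] val_lower[of x k] val_upper[of x k] by (simp add: add_divide_distrib)
qed

lemma val_decimal_of_rat [simp]: "val (decimal_of_rat r) = of_rat r"
proof -
  obtain q p where r: "r = Fract q p" and p: "p > 0"
    by (cases r) auto
  let ?x = "decimal_of_rat r"
  have *: "scaled ?x k * p + division_remainder q p k = q * 10 ^ k" for k
    by (induction k) (simp_all add: digit_decimal_of_rat_Fract p r algebra_simps)
  have **: "real_of_int (scaled ?x k) * p + division_remainder q p k = q * 10 ^ k" for k
    using arg_cong[OF *[of k], of real_of_int] by simp
  show ?thesis
  proof (rule val_eqI)
    fix k
    note b = division_remainder_bounds[OF p, of q k]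
    have "real_of_int (scaled ?x k) * p \<le> q * 10 ^ k"
      using **[of k] b(1) by linarith
    then show "real_of_int (scaled ?x k) / 10 ^ k \<le> of_rat r"
      using p by (simp add: r of_rat_rat field_simps)
    have "q * 10 ^ k \<le> (real_of_int (scaled ?x k) + 1) * p"
      using **[of k] b(2) by (simp add: algebra_simps)
    then show "of_rat r \<le> (real_of_int (scaled ?x k) + 1) / 10 ^ k"
      using p by (simp add: r of_rat_rat field_simps)
  qed
qed

lemma val_dense: "a < b \<Longrightarrow> \<exists>z. a < val z \<and> val z < b"
  using of_rat_dense[of a b] val_decimal_of_rat by metis

lemma no_strict_between_same_val:
  assumes "val x = val y"
  shows "\<not> (x < z \<and> z < y)"
proof
  assume *: "x < z \<and> z < y"
  then obtain k m where "scaled x k < scaled z k" "scaled z m < scaled y m"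
    by (auto simp: decimal_less_scaled)
  then have "scaled x (max k m) + 1 \<le> scaled z (max k m)"
      "scaled z (max k m) + 1 \<le> scaled y (max k m)"
    using scaled_less_mono by (metis max.cobounded1 max.cobounded2 zless_imp_add1_zle)+
  then have "real_of_int (scaled x (max k m)) + 2 \<le> scaled y (max k m)"
    by linarith
  then have "(real_of_int (scaled x (max k m)) + 2) / 10 ^ max k m \<le> scaled y (max k m) / 10 ^ max k m"
    by (simp add: divide_right_mono)
  then have "(real_of_int (scaled x (max k m)) + 1) / 10 ^ max k m < scaled y (max k m) / 10 ^ max k m"
    by (smt (verit) divide_strict_right_mono zero_less_power)
  then show False
    using val_upper[of x "max k m"] val_lower[of y "max k m"] assms by linarith
qed

lemma no_gap_iff_val: "x \<sim> y \<longleftrightarrow> val x = val y"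
proof
  assume "x \<sim> y"
  then show "val x = val y"
    unfolding no_gap_def
    by (metis linorder_neqE_linordered_idom val_dense val_less_imp_less)
qed (metis no_gap_def no_strict_between_same_val)

lemma equivp_no_gap: "equivp no_gap"
  by (rule equivpI) (auto simp: reflp_def symp_def transp_def no_gap_iff_val)

quotient_type dreal = decimal / no_gap
  morphisms rep_dreal dreal_class
  by (rule equivp_no_gap)

text \<open>
  Sequences are indexed by \<open>1, 2, 3, \<dots>\<close>: they are functions on \<^typ>\<open>nat\<close> whose value at \<open>0\<close>
  is disregarded. The definitions are meaningful for bounded sequences only.
\<close>

definition upper_LIMIT :: "(nat \<Rightarrow> decimal) \<Rightarrow> decimal" where
  "upper_LIMIT x = (INF n\<in>{1..}. SUP k\<in>{n..}. x k)"

definition lower_LIMIT :: "(nat \<Rightarrow> decimal) \<Rightarrow> decimal" where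
  "lower_LIMIT x = (SUP n\<in>{1..}. INF k\<in>{n..}. x k)"

definition LIMIT :: "(nat \<Rightarrow> decimal) \<Rightarrow> decimal" where
  "LIMIT x = (THE l. upper_LIMIT x = l \<and> lower_LIMIT x = l)"

lemma val_Sup_le:
  assumes "X \<noteq> {}" and "\<And>x. x \<in> X \<Longrightarrow> val x \<le> c"
  shows "bdd_above X" "val (Sup X) \<le> c"
proof -
  have bound: "x \<le> z" if "c < val z" "x \<in> X" for x z
    using val_less_imp_less[of x z] assms(2)[OF that(2)] that(1) by auto
  show "bdd_above X"
    using bound val_dense[of c "c + 1"] by (meson bdd_aboveI less_add_one)
  show "val (Sup X) \<le> c"
  proof (rule ccontr)
    assume "\<not> ?thesis"
    then obtain z where "c < val z" "val z < val (Sup X)"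
      using val_dense[of c "val (Sup X)"] by auto
    moreover from this have "Sup X \<le> z"
      using assms(1) bound by (intro cSup_least)
    ultimately show False
      using val_mono by fastforce
  qed
qed

lemma val_le_Inf:
  assumes "X \<noteq> {}" and "\<And>x. x \<in> X \<Longrightarrow> c \<le> val x"
  shows "bdd_below X" "c \<le> val (Inf X)"
proof -
  have bound: "z \<le> x" if "val z < c" "x \<in> X" for x z
    using val_less_imp_less[of z x] assms(2)[OF that(2)] that(1) by auto
  show "bdd_below X"
    using bound val_dense[of "c - 1" c] by (meson bdd_belowI diff_less_eq less_add_one)
  show "c \<le> val (Inf X)"
  proof (rule ccontr)
    assume "\<not> ?thesis"
    then obtain z where "val (Inf X) < val z" "val z < c"
      using val_dense[of "val (Inf X)" c] by auto
    moreover from this have "z \<le> Inf X"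
      using assms(1) bound by (intro cInf_greatest)
    ultimately show False
      using val_mono by fastforce
  qed
qed

lemma val_limits_bounds:
  assumes "\<And>n. n \<ge> 1 \<Longrightarrow> A \<le> val (x n) \<and> val (x n) \<le> B"
    and "N \<ge> 1" and "\<And>n. n \<ge> N \<Longrightarrow> a \<le> val (x n) \<and> val (x n) \<le> b"
  shows "a \<le> val (lower_LIMIT x)" "lower_LIMIT x \<le> upper_LIMIT x" "val (upper_LIMIT x) \<le> b"
proof -
  let ?S = "\<lambda>n. SUP k\<in>{n..}. x k" and ?I = "\<lambda>n. INF k\<in>{n..}. x k"
  have above: "bdd_above (x ` {n..})" and below: "bdd_below (x ` {n..})" if "n \<ge> 1" for n
    using assms(1) that
    by (auto intro!: val_Sup_le(1)[of _ B] val_le_Inf(1)[of _ A])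
  have S: "val (?S n) \<le> B" and I: "A \<le> val (?I n)" if "n \<ge> 1" for n
    using assms(1) that by (auto intro!: val_Sup_le(2) val_le_Inf(2))
  have SN: "val (?S N) \<le> b" and IN: "a \<le> val (?I N)"
    using assms(2,3) by (auto intro!: val_Sup_le(2) val_le_Inf(2))
  have xS: "x k \<le> ?S n" and Ix: "?I n \<le> x k" if "n \<ge> 1" "k \<ge> n" for k n
    using that above below by (auto intro: cSUP_upper cINF_lower)
  have IS: "?I n \<le> ?S m" if "n \<ge> 1" "m \<ge> 1" for n m
    using Ix[OF that(1), of "max n m"] xS[OF that(2), of "max n m"] by auto
  have bI: "bdd_above (?I ` {1..})" and bS: "bdd_below (?S ` {1..})"
    using IS[of _ 1] IS[of 1] by (auto intro!: bdd_aboveI[of _ "?S 1"] bdd_belowI[of _ "?I 1"])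
  have "?I N \<le> lower_LIMIT x"
    unfolding lower_LIMIT_def using assms(2) bI by (intro cSUP_upper) auto
  then show "a \<le> val (lower_LIMIT x)"
    using IN val_mono order_trans by blast
  have "upper_LIMIT x \<le> ?S N"
    unfolding upper_LIMIT_def using assms(2) bS by (intro cINF_lower) auto
  then show "val (upper_LIMIT x) \<le> b"
    using SN val_mono order_trans by blast
  show "lower_LIMIT x \<le> upper_LIMIT x"
    unfolding lower_LIMIT_def upper_LIMIT_def
    by (intro cSUP_least cINF_greatest IS) auto
qed

lemma limits_of_convergent:
  assumes "(\<lambda>n. val (x n)) \<longlonglongrightarrow> l"
  shows "val (lower_LIMIT x) = l" "val (upper_LIMIT x) = l" "lower_LIMIT x \<le> upper_LIMIT x"
proof -
  have "Bseq (\<lambda>n. val (x n))"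
    using assms convergentI convergent_imp_Bseq by blast
  then obtain K where K: "\<And>n. \<bar>val (x n)\<bar> \<le> K"
    by (auto simp: Bseq_def)
  have bd: "- K \<le> val (x n) \<and> val (x n) \<le> K" for n
    using K[of n] by linarith
  show le: "lower_LIMIT x \<le> upper_LIMIT x"
    using val_limits_bounds(2)[of "-K" x K 1 "-K" K] bd by auto
  have close: "l - e \<le> val (lower_LIMIT x) \<and> val (upper_LIMIT x) \<le> l + e" if "e > 0" for e
  proof -
    obtain N where N: "\<And>n. n \<ge> N \<Longrightarrow> \<bar>val (x n) - l\<bar> < e"
      using LIMSEQ_D[OF assms] \<open>e > 0\<close> by (metis real_norm_def)
    have "l - e \<le> val (x n) \<and> val (x n) \<le> l + e" if "n \<ge> max N 1" for n
      using N[of n] that by auto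
    then show ?thesis
      using val_limits_bounds(1,3)[of "-K" x K "max N 1" "l - e" "l + e"] bd by auto
  qed
  have "l \<le> val (lower_LIMIT x)" "val (upper_LIMIT x) \<le> l"
    using close by (auto intro: field_le_epsilon simp: algebra_simps)
  then show "val (lower_LIMIT x) = l" "val (upper_LIMIT x) = l"
    using val_mono[OF le] by auto
qed

lemma lower_eq_upper_LIMIT_mono:
  assumes mono: "\<And>m n. 1 \<le> m \<Longrightarrow> m \<le> n \<Longrightarrow> x m \<le> x n" and bdd: "bdd_above (range x)"
  shows "lower_LIMIT x = upper_LIMIT x"
proof -
  let ?s = "SUP k\<in>{1..}. x k"
  have b: "bdd_above (x ` {n..})" for n
    using bdd by (rule bdd_above_mono) auto
  have "(INF k\<in>{n..}. x k) = x n" if "n \<ge> 1" for n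
    using mono that by (intro cInf_eq_minimum) auto
  then have "lower_LIMIT x = ?s"
    unfolding lower_LIMIT_def by (intro SUP_cong refl) simp
  moreover have sup: "(SUP k\<in>{n..}. x k) = ?s" if "n \<ge> 1" for n
  proof (rule antisym)
    show "(SUP k\<in>{n..}. x k) \<le> ?s"
      using that b by (intro cSUP_subset_mono) auto
    show "?s \<le> (SUP k\<in>{n..}. x k)"
    proof (rule cSUP_least)
      fix k :: nat assume "k \<in> {1..}"
      then have "x k \<le> x (max k n)"
        using mono by auto
      also have "\<dots> \<le> (SUP k\<in>{n..}. x k)"
        using b by (intro cSUP_upper) auto
      finally show "x k \<le> (SUP k\<in>{n..}. x k)" .
    qed simp
  qed
  have "upper_LIMIT x = (INF n\<in>{1::nat..}. ?s)"
    unfolding upper_LIMIT_def by (rule INF_cong[OF refl], rule sup) simp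
  then have "upper_LIMIT x = ?s"
    by simp
  ultimately show ?thesis
    by simp
qed

lemma LIMIT_eq: "lower_LIMIT x = upper_LIMIT x \<Longrightarrow> LIMIT x = lower_LIMIT x"
  by (simp add: LIMIT_def)

definition oplus :: "decimal \<Rightarrow> decimal \<Rightarrow> decimal"  (infixl \<open>\<oplus>\<close> 65) where
  "x \<oplus> y = LIMIT (\<lambda>k. decimal_of_rat (trunc x k + trunc y k))"

lemma decimal_of_rat_mono: "r \<le> s \<Longrightarrow> decimal_of_rat r \<le> decimal_of_rat s"
  by (cases "r = s") (auto intro!: less_imp_le val_less_imp_less simp: of_rat_less)

lemma of_rat_trunc: "of_rat (trunc x k) = real_of_int (scaled x k) / 10 ^ k"
  by (simp add: trunc_scaled of_rat_divide of_rat_power)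

lemma trunc_tendsto: "(\<lambda>k. real_of_rat (trunc x k)) \<longlonglongrightarrow> val x"
proof (rule tendsto_sandwich)
  show "\<forall>\<^sub>F k in sequentially. val x - (1 / 10) ^ k \<le> real_of_rat (trunc x k)"
    using val_upper[of x] by (simp add: of_rat_trunc add_divide_distrib power_one_over algebra_simps)
  show "\<forall>\<^sub>F k in sequentially. real_of_rat (trunc x k) \<le> val x"
    using val_lower[of x] by (simp add: of_rat_trunc)
  have "(\<lambda>k. val x - (1 / 10) ^ k) \<longlonglongrightarrow> val x - 0"
    by (intro tendsto_intros LIMSEQ_power_zero) auto
  then show "(\<lambda>k. val x - (1 / 10) ^ k) \<longlonglongrightarrow> val x"
    by simp
qed simp

lemma trunc_mono: "m \<le> n \<Longrightarrow> trunc x m \<le> trunc x n"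
proof (rule lift_Suc_mono_le)
  show "trunc x k \<le> trunc x (Suc k)" for k
    using digit_bounds[of x k] by (simp add: trunc_def)
qed

text \<open>The limit defining the sum exists, that is, lower and upper limit agree.\<close>

lemma oplus_limits:
  "x \<oplus> y = lower_LIMIT (\<lambda>k. decimal_of_rat (trunc x k + trunc y k))"
  "x \<oplus> y = upper_LIMIT (\<lambda>k. decimal_of_rat (trunc x k + trunc y k))"
proof -
  let ?s = "\<lambda>k. decimal_of_rat (trunc x k + trunc y k)"
  have "real_of_rat (trunc x k + trunc y k) \<le> val x + val y" for k
    using val_lower[of x k] val_lower[of y k] by (simp add: of_rat_add of_rat_trunc)
  then have "bdd_above (range ?s)"
    by (intro val_Sup_le(1)[where c = "val x + val y"]) auto
  then have "lower_LIMIT ?s = upper_LIMIT ?s"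
    by (intro lower_eq_upper_LIMIT_mono decimal_of_rat_mono add_mono trunc_mono) auto
  then show "x \<oplus> y = lower_LIMIT ?s" "x \<oplus> y = upper_LIMIT ?s"
    by (simp_all add: oplus_def LIMIT_eq)
qed

lemma val_oplus: "val (x \<oplus> y) = val x + val y"
  unfolding oplus_limits(1)
  by (intro limits_of_convergent(1)) (simp add: of_rat_add tendsto_add trunc_tendsto)

lift_definition dreal_plus :: "dreal \<Rightarrow> dreal \<Rightarrow> dreal"  (infixl \<open>\<oplus>\<^sub>\<real>\<close> 65) is oplus
  by (simp add: no_gap_iff_val val_oplus)

definition CR :: "(nat \<Rightarrow> rat) set" where
  "CR = {x. \<forall>\<epsilon>>0. \<exists>N\<ge>1. \<forall>m\<ge>N. \<forall>n\<ge>N. \<bar>x m - x n\<bar> < \<epsilon>}"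

definition boxplus :: "(nat \<Rightarrow> rat) \<Rightarrow> (nat \<Rightarrow> rat) \<Rightarrow> nat \<Rightarrow> rat"  (infixl \<open>\<boxplus>\<close> 65) where
  "x \<boxplus> y = (\<lambda>n. x n + y n)"

definition kappa :: "(nat \<Rightarrow> rat) \<Rightarrow> dreal"  (\<open>\<kappa>\<close>) where
  "\<kappa> x = dreal_class (lower_LIMIT (\<lambda>n. decimal_of_rat (x n)))"

lemma CR_convergent:
  assumes "x \<in> CR"
  shows "convergent (\<lambda>n. real_of_rat (x n))"
proof (rule Cauchy_convergent, rule CauchyI)
  fix e :: real assume "e > 0"
  then obtain r where r: "0 < r" "real_of_rat r < e"
    using of_rat_dense[of 0 e] by auto
  then obtain N where "\<And>m n. m \<ge> N \<Longrightarrow> n \<ge> N \<Longrightarrow> \<bar>x m - x n\<bar> < r"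
    using assms unfolding CR_def by blast
  then have "\<bar>real_of_rat (x m) - real_of_rat (x n)\<bar> < e" if "m \<ge> N" "n \<ge> N" for m n
    using that r(2) less_trans[of _ "real_of_rat r" e]
    by (metis abs_of_rat of_rat_diff of_rat_less)
  then show "\<exists>M. \<forall>m\<ge>M. \<forall>n\<ge>M. norm (real_of_rat (x m) - real_of_rat (x n)) < e"
    by auto
qed

text \<open>For Cauchy sequences the upper limit may be used in place of the lower one.\<close>

lemma kappa_upper:
  assumes "x \<in> CR"
  shows "\<kappa> x = dreal_class (upper_LIMIT (\<lambda>n. decimal_of_rat (x n)))"
proof -
  obtain l where "(\<lambda>n. val (decimal_of_rat (x n))) \<longlonglongrightarrow> l"
    using CR_convergent[OF assms] by (auto simp: convergent_def)
  then have "lower_LIMIT (\<lambda>n. decimal_of_rat (x n)) \<sim> upper_LIMIT (\<lambda>n. decimal_of_rat (x n))"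
    by (simp add: no_gap_iff_val limits_of_convergent)
  then show ?thesis
    by (simp add: kappa_def dreal.abs_eq_iff)
qed

end

theory Submission
  imports Defs
begin

text \<open>
  The map \<^const>\<open>val\<close> identifies \<open>\<R>/\<sim>\<close> with the real numbers and turns \<open>\<oplus>\<close> into real addition.
  Under this identification \<open>\<kappa>\<close> is the ordinary limit of a Cauchy sequence, so the claim reduces to
  the additivity of limits.
\<close>

text \<open>The lower limit defining \<open>\<kappa> x\<close> has the same \<open>val\<close> as
  \<open>d\<close>, and decimals with equal \<open>val\<close> have no gap.\<close>

lemma kappa_eqI:
  assumes "(\<lambda>n. real_of_rat (x n)) \<longlonglongrightarrow> val d"
  shows "\<kappa> x = dreal_class d"
  using assms
  by (simp add: kappa_def dreal.abs_eq_iff no_gap_iff_val limits_of_convergent(1) val_decimal_of_rat)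

text \<open>Supplies a decimal whose \<open>val\<close> is the real limit: the lower limit of the
  sequence itself serves as \<open>d\<close>.\<close>

lemma kappa_cases:
  assumes "x \<in> CR"
  obtains d where "(\<lambda>n. real_of_rat (x n)) \<longlonglongrightarrow> val d" "\<kappa> x = dreal_class d"
proof -
  obtain l where l: "(\<lambda>n. real_of_rat (x n)) \<longlonglongrightarrow> l"
    using CR_convergent[OF assms] by (auto simp: convergent_def)
  then have "val (lower_LIMIT (\<lambda>n. decimal_of_rat (x n))) = l"
    by (intro limits_of_convergent(1)) (simp add: val_decimal_of_rat)
  with l show thesis
    by (intro that[of "lower_LIMIT (\<lambda>n. decimal_of_rat (x n))"]) (simp_all add: kappa_def)
qed

theorem theorem7p5:
  fixes x y :: "nat \<Rightarrow> rat"
  assumes "x \<in> CR" and "y \<in> CR"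
  shows "\<kappa> (x \<boxplus> y) = \<kappa> x \<oplus>\<^sub>\<real> \<kappa> y"
proof -
  obtain a where a: "(\<lambda>n. real_of_rat (x n)) \<longlonglongrightarrow> val a" "\<kappa> x = dreal_class a"
    using assms(1) by (rule kappa_cases)
  obtain b where b: "(\<lambda>n. real_of_rat (y n)) \<longlonglongrightarrow> val b" "\<kappa> y = dreal_class b"
    using assms(2) by (rule kappa_cases)
  \<comment> \<open>\<open>val_oplus\<close> turns the limit \<open>val a + val b\<close> into the
    \<open>val\<close> of a single decimal, as \<open>kappa_eqI\<close> requires.\<close>
  have "(\<lambda>n. real_of_rat ((x \<boxplus> y) n)) \<longlonglongrightarrow> val (a \<oplus> b)"
    using tendsto_add[OF a(1) b(1)] by (simp add: boxplus_def of_rat_add val_oplus)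
  then have "\<kappa> (x \<boxplus> y) = dreal_class (a \<oplus> b)"
    by (rule kappa_eqI)
  then show ?thesis
    by (simp add: a(2) b(2) dreal_plus.abs_eq)
qed

end
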